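(* Let $\alpha,\beta\in\mathbb{R}$ and $\eta\in\{1,-1\}$, and let $(G_4,g,J)$ be the connected, simply connected three-dimensional Lie group with left-invariant Lorentzian metric $g$ whose Lie algebra $\mathfrak{g}$ has a pseudo-orthonormal basis $\{e_1,e_2,e_3\}$ with $e_3$ timelike such that $$[e_1,e_2]=-e_2+(2\eta-\beta)e_3,\quad [e_1,e_3]=-\beta e_2+e_3,\quad [e_2,e_3]=\alpha e_1,$$ equipped with the product structure $Je_1=e_1$, $Je_2=e_2$, $Je_3=-e_3$. Let $c\in\mathbb{R}$. Then $(G_4,g,J)$ is a first kind algebraic Wanas soliton associated to the canonical connection $\nabla^0$ with constant $c$ (i.e. $\mathrm{Wan}^0=c\,\mathrm{Id}+D$ with $D$ a derivation of $\mathfrak g$) if and only if one of the following holds: (i) $\alpha=\beta=0$, $c=-4$; in particular $De_1=0$, $De_2=e_2+\eta e_3$, $De_3=2e_3$. (ii) $\alpha=0$, $\beta=\eta$, $c=-1$; in particular $De_1=0$, $De_2=-e_2+\eta e_3$, $De_3=-\eta e_2+e_3$.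
   Context: Pseudo-orthonormal with $e_3$ timelike means $g(e_1,e_1)=g(e_2,e_2)=1$, $g(e_3,e_3)=-1$, $g(e_i,e_j)=0$ for $i\ne j$. All tensors are left-invariant and evaluated on the Lie algebra $\mathfrak{g}$ of left-invariant vector fields. Let $\nabla$ be the Levi-Civita connection of $g$, and let $J$ be the product structure given in the claim, with $(\nabla_XJ)Y=\nabla_X(JY)-J(\nabla_XY)$. Canonical connection: $\nabla^0_XY=\nabla_XY-\frac12(\nabla_XJ)JY$. Curvature: $R^0(X,Y)Z=\nabla^0_X\nabla^0_YZ-\nabla^0_Y\nabla^0_XZ-\nabla^0_{[X,Y]}Z$. Torsion: $T^0(X,Y)=\nabla^0_XY-\nabla^0_YX-[X,Y]$. $A^0(X,Y)Z=T^0(T^0(X,Y),Z)$, and the Wanas tensor is $W^0(X,Y)Z=R^0(X,Y)Z-A^0(X,Y)Z$. $w^0(X,Y)=-g(W^0(X,e_1)Y,e_1)-g(W^0(X,e_2)Y,e_2)+g(W^0(X,e_3)Y,e_3)$. The operator $\mathrm{Wan}^0:\mathfrak g\to\mathfrak g$ is defined by $w^0(X,Y)=g(\mathrm{Wan}^0(X),Y)$. A derivation of $\mathfrak g$ is a linear map $D$ with $D[X,Y]=[DX,Y]+[X,DY]$ for all $X,Y\in\mathfrak g$. $(G_4,g,J)$ is a first kind algebraic Wanas soliton associated to $\nabla^0$ (with constant $c$) if $\mathrm{Wan}^0=c\,\mathrm{Id}+D$ for the real number $c$ and a derivation $D$ of $\mathfrak g$. *)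

theory Defs
  imports "HOL-Analysis.Analysis"
begin

text \<open>
  A connected, simply connected Lie group is determined by its Lie algebra, and left-invariant
  tensors on it are the same thing as multilinear maps on that Lie algebra. Accordingly, the Lie
  algebra is the real vector space given by a type \<open>'a\<close> with a bracket \<open>br\<close>, and
  the metric \<open>g\<close>, the product structure \<open>J\<close> and all connections are (multi)linear
  maps on \<open>'a\<close>.
\<close>

definition lie_bracket :: "('a::real_vector \<Rightarrow> 'a \<Rightarrow> 'a) \<Rightarrow> bool" where
  "lie_bracket br \<longleftrightarrow> bilinear br \<and> (\<forall>X. br X X = 0) \<and>
     (\<forall>X Y Z. br X (br Y Z) + br Y (br Z X) + br Z (br X Y) = 0)"

definition lie_derivation :: "('a::real_vector \<Rightarrow> 'a \<Rightarrow> 'a) \<Rightarrow> ('a \<Rightarrow> 'a) \<Rightarrow> bool" where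
  "lie_derivation br D \<longleftrightarrow> linear D \<and> (\<forall>X Y. D (br X Y) = br (D X) Y + br X (D Y))"

definition pseudo_metric :: "('a::real_vector \<Rightarrow> 'a \<Rightarrow> real) \<Rightarrow> bool" where
  "pseudo_metric g \<longleftrightarrow> bilinear g \<and> (\<forall>X Y. g X Y = g Y X) \<and>
     (\<forall>X. (\<forall>Y. g X Y = 0) \<longrightarrow> X = 0)"

text \<open>The last basis vector is the timelike one. For a pseudo-metric, having such a basis says that
  the space is three-dimensional and the metric Lorentzian.\<close>

definition pseudo_orthonormal_basis ::
    "('a::real_vector \<Rightarrow> 'a \<Rightarrow> real) \<Rightarrow> 'a \<Rightarrow> 'a \<Rightarrow> 'a \<Rightarrow> bool" where
  "pseudo_orthonormal_basis g e1 e2 e3 \<longleftrightarrow>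
     distinct [e1, e2, e3] \<and> independent {e1, e2, e3} \<and> span {e1, e2, e3} = UNIV \<and>
     g e1 e1 = 1 \<and> g e2 e2 = 1 \<and> g e3 e3 = -1 \<and>
     g e1 e2 = 0 \<and> g e1 e3 = 0 \<and> g e2 e3 = 0"

text \<open>The Levi-Civita connection is the torsion-free metric connection. On left-invariant fields the
  function \<open>g Y Z\<close> is constant, so the term \<open>X (g Y Z)\<close> of metric compatibility
  vanishes.\<close>

definition is_levi_civita ::
    "('a::real_vector \<Rightarrow> 'a \<Rightarrow> 'a) \<Rightarrow> ('a \<Rightarrow> 'a \<Rightarrow> real) \<Rightarrow> ('a \<Rightarrow> 'a \<Rightarrow> 'a) \<Rightarrow> bool" where
  "is_levi_civita br g N \<longleftrightarrow> bilinear N \<and> (\<forall>X Y. N X Y - N Y X = br X Y) \<and>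
     (\<forall>X Y Z. g (N X Y) Z + g Y (N X Z) = 0)"

definition levi_civita ::
    "('a::real_vector \<Rightarrow> 'a \<Rightarrow> 'a) \<Rightarrow> ('a \<Rightarrow> 'a \<Rightarrow> real) \<Rightarrow> 'a \<Rightarrow> 'a \<Rightarrow> 'a" where
  "levi_civita br g = (THE N. is_levi_civita br g N)"

definition cov_deriv_endo ::
    "('a::real_vector \<Rightarrow> 'a \<Rightarrow> 'a) \<Rightarrow> ('a \<Rightarrow> 'a) \<Rightarrow> 'a \<Rightarrow> 'a \<Rightarrow> 'a" where
  "cov_deriv_endo N J X Y = N X (J Y) - J (N X Y)"

definition canonical_connection ::
    "('a::real_vector \<Rightarrow> 'a \<Rightarrow> 'a) \<Rightarrow> ('a \<Rightarrow> 'a \<Rightarrow> real) \<Rightarrow> ('a \<Rightarrow> 'a) \<Rightarrow> 'a \<Rightarrow> 'a \<Rightarrow> 'a" where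
  "canonical_connection br g J X Y =
     levi_civita br g X Y - (1/2) *\<^sub>R cov_deriv_endo (levi_civita br g) J X (J Y)"

definition curvature ::
    "('a::real_vector \<Rightarrow> 'a \<Rightarrow> 'a) \<Rightarrow> ('a \<Rightarrow> 'a \<Rightarrow> 'a) \<Rightarrow> 'a \<Rightarrow> 'a \<Rightarrow> 'a \<Rightarrow> 'a" where
  "curvature br N X Y Z = N X (N Y Z) - N Y (N X Z) - N (br X Y) Z"

definition torsion ::
    "('a::real_vector \<Rightarrow> 'a \<Rightarrow> 'a) \<Rightarrow> ('a \<Rightarrow> 'a \<Rightarrow> 'a) \<Rightarrow> 'a \<Rightarrow> 'a \<Rightarrow> 'a" where
  "torsion br N X Y = N X Y - N Y X - br X Y"

definition wanas_tensor ::
    "('a::real_vector \<Rightarrow> 'a \<Rightarrow> 'a) \<Rightarrow> ('a \<Rightarrow> 'a \<Rightarrow> 'a) \<Rightarrow> 'a \<Rightarrow> 'a \<Rightarrow> 'a \<Rightarrow> 'a" where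
  "wanas_tensor br N X Y Z = curvature br N X Y Z - torsion br N (torsion br N X Y) Z"

definition wanas_form ::
    "('a::real_vector \<Rightarrow> 'a \<Rightarrow> 'a) \<Rightarrow> ('a \<Rightarrow> 'a \<Rightarrow> real) \<Rightarrow> ('a \<Rightarrow> 'a \<Rightarrow> 'a) \<Rightarrow>
     'a \<Rightarrow> 'a \<Rightarrow> 'a \<Rightarrow> 'a \<Rightarrow> 'a \<Rightarrow> real" where
  "wanas_form br g N e1 e2 e3 X Y =
     - g (wanas_tensor br N X e1 Y) e1 - g (wanas_tensor br N X e2 Y) e2
     + g (wanas_tensor br N X e3 Y) e3"

definition wanas_operator ::
    "('a::real_vector \<Rightarrow> 'a \<Rightarrow> 'a) \<Rightarrow> ('a \<Rightarrow> 'a \<Rightarrow> real) \<Rightarrow> ('a \<Rightarrow> 'a \<Rightarrow> 'a) \<Rightarrow>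
     'a \<Rightarrow> 'a \<Rightarrow> 'a \<Rightarrow> 'a \<Rightarrow> 'a" where
  "wanas_operator br g N e1 e2 e3 =
     (THE A. \<forall>X Y. wanas_form br g N e1 e2 e3 X Y = g (A X) Y)"

definition first_kind_soliton_with ::
    "('a::real_vector \<Rightarrow> 'a \<Rightarrow> 'a) \<Rightarrow> ('a \<Rightarrow> 'a \<Rightarrow> real) \<Rightarrow> ('a \<Rightarrow> 'a) \<Rightarrow>
     'a \<Rightarrow> 'a \<Rightarrow> 'a \<Rightarrow> real \<Rightarrow> ('a \<Rightarrow> 'a) \<Rightarrow> bool" where
  "first_kind_soliton_with br g J e1 e2 e3 c D \<longleftrightarrow> lie_derivation br D \<and>
     (\<forall>X. wanas_operator br g (canonical_connection br g J) e1 e2 e3 X = c *\<^sub>R X + D X)"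

definition first_kind_soliton ::
    "('a::real_vector \<Rightarrow> 'a \<Rightarrow> 'a) \<Rightarrow> ('a \<Rightarrow> 'a \<Rightarrow> real) \<Rightarrow> ('a \<Rightarrow> 'a) \<Rightarrow>
     'a \<Rightarrow> 'a \<Rightarrow> 'a \<Rightarrow> real \<Rightarrow> bool" where
  "first_kind_soliton br g J e1 e2 e3 c \<longleftrightarrow>
     (\<exists>D. first_kind_soliton_with br g J e1 e2 e3 c D)"


subsection \<open>The definite descriptions above are well-defined\<close>

lemma pseudo_metric_eqI:
  assumes "pseudo_metric g" and "\<And>Z. g X Z = g Y Z"
  shows "X = Y"
proof -
  have "bilinear g"
    using assms(1) by (simp add: pseudo_metric_def)
  then have "g (X - Y) Z = 0" for Z
    using assms(2)[of Z] by (simp only: bilinear_lsub diff_self)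
  then show ?thesis
    using assms(1) unfolding pseudo_metric_def by (metis eq_iff_diff_eq_0)
qed

lemma pseudo_metric_represent:
  assumes g: "pseudo_metric g" and e: "pseudo_orthonormal_basis g e1 e2 e3" and "linear f"
  shows "g (f e1 *\<^sub>R e1 + f e2 *\<^sub>R e2 - f e3 *\<^sub>R e3) Z = f Z"
proof -
  let ?v = "f e1 *\<^sub>R e1 + f e2 *\<^sub>R e2 - f e3 *\<^sub>R e3"
  have bi: "bilinear g" and sym: "\<And>X Y. g X Y = g Y X"
    using g by (auto simp: pseudo_metric_def)
  have Z: "Z \<in> span {e1, e2, e3}"
    using e by (auto simp: pseudo_orthonormal_basis_def)
  have "linear (g ?v)"
    using bi by (simp add: bilinear_def)
  moreover have "g ?v x = f x" if "x \<in> {e1, e2, e3}" for x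
    using that e sym[of e2 e1] sym[of e3 e1] sym[of e3 e2]
    by (auto simp: pseudo_orthonormal_basis_def bilinear_ladd[OF bi] bilinear_lsub[OF bi]
        bilinear_lmul[OF bi])
  ultimately show ?thesis
    using linear_eq_on_span[OF _ \<open>linear f\<close>] Z by blast
qed

lemma levi_civita_koszul:
  assumes g: "pseudo_metric g" and N: "is_levi_civita br g N"
  shows "2 * g (N X Y) Z = g (br X Y) Z - g (br Y Z) X + g (br Z X) Y"
proof -
  have bi: "bilinear g" and sym: "\<And>X Y. g X Y = g Y X"
    using g by (auto simp: pseudo_metric_def)
  have m: "g (N X Y) Z + g (N X Z) Y = 0" for X Y Z
    using N sym by (simp add: is_levi_civita_def)
  have t: "g (br X Y) Z = g (N X Y) Z - g (N Y X) Z" for X Y Z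
    using N by (metis bi bilinear_lsub is_levi_civita_def)
  show ?thesis
    using m[of X Y Z] m[of Y Z X] m[of Z X Y] by (simp add: t)
qed

lemma ex1_levi_civita:
  assumes br: "lie_bracket br" and g: "pseudo_metric g" and e: "pseudo_orthonormal_basis g e1 e2 e3"
  shows "\<exists>!N. is_levi_civita br g N"
proof -
  have bi: "bilinear g" and sym: "\<And>X Y. g X Y = g Y X"
    using g by (auto simp: pseudo_metric_def)
  have bb: "bilinear br" and alt: "\<And>X. br X X = 0"
    using br by (auto simp: lie_bracket_def)
  have skew: "br Y X = - br X Y" for X Y
  proof -
    have "br (X + Y) (X + Y) = (br X X + br X Y) + (br Y X + br Y Y)"
      by (simp only: bilinear_ladd[OF bb] bilinear_radd[OF bb] ac_simps)
    then have "br Y X + br X Y = 0"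
      by (simp add: alt add.commute)
    then show ?thesis
      by (simp only: eq_neg_iff_add_eq_0)
  qed
  note lin = bilinear_ladd[OF bi] bilinear_radd[OF bi] bilinear_lmul[OF bi] bilinear_rmul[OF bi]
    bilinear_ladd[OF bb] bilinear_radd[OF bb] bilinear_lmul[OF bb] bilinear_rmul[OF bb]
    bilinear_lneg[OF bi] bilinear_rneg[OF bi] bilinear_lsub[OF bi] bilinear_rsub[OF bi]
  define k where "k X Y Z = (g (br X Y) Z - g (br Y Z) X + g (br Z X) Y) / 2" for X Y Z
  define N where "N X Y = k X Y e1 *\<^sub>R e1 + k X Y e2 *\<^sub>R e2 - k X Y e3 *\<^sub>R e3" for X Y
  have "linear (k X Y)" for X Y
    by (rule linearI) (simp_all add: k_def lin field_simps)
  then have gN: "g (N X Y) Z = k X Y Z" for X Y Z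
    unfolding N_def by (rule pseudo_metric_represent[OF g e])
  have "bilinear N"
    unfolding bilinear_def
    by (intro conjI allI linearI; rule pseudo_metric_eqI[OF g])
      (simp_all add: lin gN, simp_all add: k_def lin field_simps)
  moreover have "N X Y - N Y X = br X Y" for X Y
  proof (rule pseudo_metric_eqI[OF g])
    fix Z
    show "g (N X Y - N Y X) Z = g (br X Y) Z"
      unfolding lin gN k_def skew[of X Y] skew[of X Z] skew[of Y Z] lin by (simp add: field_simps)
  qed
  moreover have "g (N X Y) Z + g Y (N X Z) = 0" for X Y Z
    unfolding sym[of Y] gN k_def skew[of X Y] skew[of X Z] skew[of Y Z] lin by (simp add: field_simps)
  ultimately have "is_levi_civita br g N"
    by (simp add: is_levi_civita_def)
  moreover have "M = N" if M: "is_levi_civita br g M" for M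
  proof (intro ext pseudo_metric_eqI[OF g])
    fix X Y Z
    show "g (M X Y) Z = g (N X Y) Z"
      using levi_civita_koszul[OF g M, of X Y Z] by (simp add: gN k_def)
  qed
  ultimately show ?thesis by blast
qed

lemma bilinear_canonical_connection:
  assumes "lie_bracket br" and "pseudo_metric g" and "pseudo_orthonormal_basis g e1 e2 e3"
    and J: "linear J"
  shows "bilinear (canonical_connection br g J)"
proof -
  have "is_levi_civita br g (levi_civita br g)"
    unfolding levi_civita_def using ex1_levi_civita[OF assms(1-3)] by (rule theI')
  then have N: "bilinear (levi_civita br g)"
    by (simp add: is_levi_civita_def)
  show ?thesis
    unfolding bilinear_def
    by (intro conjI allI linearI)
      (simp_all add: canonical_connection_def cov_deriv_endo_def linear_add[OF J] linear_scale[OF J]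
        bilinear_ladd[OF N] bilinear_radd[OF N] bilinear_lmul[OF N] bilinear_rmul[OF N]
        algebra_simps)
qed

lemma ex1_wanas_operator:
  assumes "lie_bracket br" and g: "pseudo_metric g" and e: "pseudo_orthonormal_basis g e1 e2 e3"
    and N: "bilinear N"
  shows "\<exists>!A. \<forall>X Y. wanas_form br g N e1 e2 e3 X Y = g (A X) Y"
proof -
  let ?w = "wanas_form br g N e1 e2 e3"
  let ?A = "\<lambda>X. ?w X e1 *\<^sub>R e1 + ?w X e2 *\<^sub>R e2 - ?w X e3 *\<^sub>R e3"
  have bi: "bilinear g" and bb: "bilinear br"
    using assms by (auto simp: pseudo_metric_def lie_bracket_def)
  have "linear (?w X)" for X
    by (rule linearI)
      (simp_all add: wanas_form_def wanas_tensor_def curvature_def torsion_def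
        bilinear_ladd[OF bi] bilinear_lmul[OF bi] bilinear_lsub[OF bi]
        bilinear_ladd[OF N] bilinear_lmul[OF N] bilinear_radd[OF N] bilinear_rmul[OF N]
        bilinear_radd[OF bb] bilinear_rmul[OF bb] algebra_simps)
  then have A: "g (?A X) Y = ?w X Y" for X Y
    by (rule pseudo_metric_represent[OF g e])
  show ?thesis
  proof (rule ex1I)
    show "\<forall>X Y. ?w X Y = g (?A X) Y"
      using A by simp
  next
    fix B
    assume "\<forall>X Y. ?w X Y = g (B X) Y"
    then show "B = ?A"
      using A by (intro ext pseudo_metric_eqI[OF g]) simp
  qed
qed

end

theory Submission
  imports Defs
begin

text \<open>
  Since \<open>J\<close> is an isometric involution, the canonical connection is
  \<open>(\<nabla>\<^sub>X + J \<nabla>\<^sub>X J) / 2\<close>; it annihilates \<open>e3\<close> and rotates the plane of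
  \<open>e1\<close> and \<open>e2\<close>, so the Wanas operator is easily computed on the frame: it scales
  \<open>e1\<close> and preserves the plane of \<open>e2\<close> and \<open>e3\<close>. For a linear map
  \<open>D\<close> of this shape, with eigenvalue \<open>x\<close> on \<open>e1\<close>, being a derivation means
  \<open>[D, M] = x M\<close> on that plane, where \<open>M = ad e1\<close>, together with
  \<open>\<alpha> (tr D - x) = \<alpha> x\<close>, where \<open>tr D - x\<close> is the trace on the plane.
  As \<open>tr (M\<^sup>2) = 2 (\<beta> - \<eta>)\<^sup>2\<close>, the first condition forces \<open>x = 0\<close> and
  \<open>D\<close> to lie in the span of \<open>M\<close> and the identity unless \<open>\<beta> = \<eta>\<close>.
\<close>

section \<open>Components in a pseudo-orthonormal frame\<close>

locale lorentzian_frame =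
  fixes br :: "'a::real_vector \<Rightarrow> 'a \<Rightarrow> 'a"
    and g :: "'a \<Rightarrow> 'a \<Rightarrow> real"
    and e1 e2 e3 :: 'a
  assumes bracket: "lie_bracket br"
    and metric: "pseudo_metric g"
    and basis: "pseudo_orthonormal_basis g e1 e2 e3"
begin

lemma bilinear_g: "bilinear g" and g_commute: "g X Y = g Y X"
  using metric by (auto simp: pseudo_metric_def)

lemma bilinear_br: "bilinear br" and br_self [simp]: "br X X = 0"
  using bracket by (auto simp: lie_bracket_def)

lemma br_skew: "br X Y = - br Y X"
proof -
  have "br (X + Y) (X + Y) = br X X + br Y X + (br X Y + br Y Y)"
    by (simp only: bilinear_ladd[OF bilinear_br] bilinear_radd[OF bilinear_br])
  then have "br Y X + br X Y = 0"
    by (simp only: br_self add_0_left add_0_right)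
  then show ?thesis
    by (simp only: eq_neg_iff_add_eq_0 add.commute)
qed

lemma g_frame [simp]:
  "g e1 e1 = 1" "g e2 e2 = 1" "g e3 e3 = -1" "g e1 e2 = 0" "g e1 e3 = 0" "g e2 e3 = 0"
  "g e2 e1 = 0" "g e3 e1 = 0" "g e3 e2 = 0"
  using basis
  by (simp_all add: pseudo_orthonormal_basis_def g_commute[of e2 e1] g_commute[of e3 e1]
      g_commute[of e3 e2])

lemmas g_linear =
  bilinear_ladd[OF bilinear_g] bilinear_radd[OF bilinear_g]
  bilinear_lsub[OF bilinear_g] bilinear_rsub[OF bilinear_g]
  bilinear_lneg[OF bilinear_g] bilinear_rneg[OF bilinear_g]
  bilinear_lmul[OF bilinear_g] bilinear_rmul[OF bilinear_g]
  bilinear_lzero[OF bilinear_g] bilinear_rzero[OF bilinear_g]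

lemmas br_linear =
  bilinear_ladd[OF bilinear_br] bilinear_radd[OF bilinear_br]
  bilinear_lsub[OF bilinear_br] bilinear_rsub[OF bilinear_br]
  bilinear_lneg[OF bilinear_br] bilinear_rneg[OF bilinear_br]
  bilinear_lmul[OF bilinear_br] bilinear_rmul[OF bilinear_br]
  bilinear_lzero[OF bilinear_br] bilinear_rzero[OF bilinear_br]

lemma frame_expansion: "g X e1 *\<^sub>R e1 + g X e2 *\<^sub>R e2 - g X e3 *\<^sub>R e3 = X"
proof (rule pseudo_metric_eqI[OF metric])
  have "linear (g X)"
    using bilinear_g by (simp add: bilinear_def)
  then show "g (g X e1 *\<^sub>R e1 + g X e2 *\<^sub>R e2 - g X e3 *\<^sub>R e3) Z = g X Z" for Z
    by (rule pseudo_metric_represent[OF metric basis])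
qed

lemma frame_eqI:
  assumes "g X e1 = g Y e1" "g X e2 = g Y e2" "g X e3 = g Y e3"
  shows "X = Y"
  by (rule trans[OF frame_expansion[symmetric]]) (simp only: assms frame_expansion)

lemma frame_eq_iff: "X = Y \<longleftrightarrow> g X e1 = g Y e1 \<and> g X e2 = g Y e2 \<and> g X e3 = g Y e3"
  by (auto intro: frame_eqI)

text \<open>Both sides of the Leibniz rule are bilinear and alternating, so three of the nine frame
  pairs decide it.\<close>

lemma lie_derivation_frameI:
  assumes D: "linear D"
    and frame: "D (br e1 e2) = br (D e1) e2 + br e1 (D e2)"
      "D (br e1 e3) = br (D e1) e3 + br e1 (D e3)"
      "D (br e2 e3) = br (D e2) e3 + br e2 (D e3)"
  shows "lie_derivation br D"
proof -
  have l: "bilinear (\<lambda>X Y. D (br X Y))" and r: "bilinear (\<lambda>X Y. br (D X) Y + br X (D Y))"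
    unfolding bilinear_def
    by (auto intro!: linearI simp: br_linear linear_add[OF D] linear_scale[OF D] algebra_simps)
  have skew: "D (br Y X) = br (D Y) X + br Y (D X)"
    if "D (br X Y) = br (D X) Y + br X (D Y)" for X Y
    using that by (simp add: br_skew[of Y X] br_skew[of "D Y" X] br_skew[of Y "D X"] linear_neg[OF D])
  have self: "D 0 = br (D X) X + br X (D X)" for X
    by (simp add: linear_0[OF D] br_skew[of "D X" X])
  have span: "X \<in> span {e1, e2, e3}" for X
    using basis by (auto simp: pseudo_orthonormal_basis_def)
  have "D (br X Y) = br (D X) Y + br X (D Y)" for X Y
    by (rule bilinear_eq[OF l r subset_refl subset_refl span span])
      (auto simp: self frame frame[THEN skew])
  then show ?thesis
    using D by (simp add: lie_derivation_def)
qed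

lemma is_levi_civita: "is_levi_civita br g (levi_civita br g)"
  unfolding levi_civita_def using ex1_levi_civita[OF bracket metric basis] by (rule theI')

lemma g_levi_civita:
  "g (levi_civita br g X Y) Z = (g (br X Y) Z - g (br Y Z) X + g (br Z X) Y) / 2"
  using levi_civita_koszul[OF metric is_levi_civita, of X Y Z]
  by (simp only: eq_divide_eq mult.commute[of 2]) simp

lemma g_wanas_operator:
  assumes "bilinear N"
  shows "g (wanas_operator br g N e1 e2 e3 X) Y = wanas_form br g N e1 e2 e3 X Y"
  unfolding wanas_operator_def
  using theI'[OF ex1_wanas_operator[OF bracket metric basis assms]] by metis

text \<open>The Wanas form is linear in its first argument, and nondegeneracy of \<open>g\<close>
  carries this over to the operator. Its values on the frame then determine it.\<close>

lemma linear_wanas_operator: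
  assumes N: "bilinear N"
  shows "linear (wanas_operator br g N e1 e2 e3)"
proof (rule linearI)
  note lin = g_linear br_linear bilinear_ladd[OF N] bilinear_lmul[OF N] bilinear_radd[OF N]
    bilinear_rmul[OF N] bilinear_lsub[OF N] bilinear_rsub[OF N]
  fix X Y and r :: real
  show "wanas_operator br g N e1 e2 e3 (X + Y) =
      wanas_operator br g N e1 e2 e3 X + wanas_operator br g N e1 e2 e3 Y"
    by (rule pseudo_metric_eqI[OF metric])
      (simp add: lin g_wanas_operator[OF N] wanas_form_def wanas_tensor_def curvature_def
        torsion_def)
  show "wanas_operator br g N e1 e2 e3 (r *\<^sub>R X) = r *\<^sub>R wanas_operator br g N e1 e2 e3 X"
    by (rule pseudo_metric_eqI[OF metric])
      (simp add: lin g_wanas_operator[OF N] wanas_form_def wanas_tensor_def curvature_def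
        torsion_def algebra_simps)
qed

end

section \<open>Canonical connection, Wanas operator and derivations of the given Lie algebra\<close>

locale lie_algebra_G4 = lorentzian_frame br g e1 e2 e3
  for br :: "'a::real_vector \<Rightarrow> 'a \<Rightarrow> 'a" and g and e1 e2 e3 :: 'a +
  fixes J :: "'a \<Rightarrow> 'a" and \<alpha> \<beta> \<eta> :: real
  assumes eta: "\<eta> \<in> {1, -1}"
    and br12 [simp]: "br e1 e2 = - e2 + (2 * \<eta> - \<beta>) *\<^sub>R e3"
    and br13 [simp]: "br e1 e3 = - \<beta> *\<^sub>R e2 + e3"
    and br23 [simp]: "br e2 e3 = \<alpha> *\<^sub>R e1"
    and linear_J: "linear J"
    and J_frame [simp]: "J e1 = e1" "J e2 = e2" "J e3 = - e3"
begin

lemma br_frame_skew [simp]: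
  "br e2 e1 = e2 - (2 * \<eta> - \<beta>) *\<^sub>R e3"
  "br e3 e1 = \<beta> *\<^sub>R e2 - e3"
  "br e3 e2 = - \<alpha> *\<^sub>R e1"
  by (simp_all add: br_skew[of e2 e1] br_skew[of e3 e1] br_skew[of e3 e2])

abbreviation N0 where "N0 \<equiv> canonical_connection br g J"

lemma bilinear_N0: "bilinear N0"
  by (rule bilinear_canonical_connection[OF bracket metric basis linear_J])

lemmas N0_linear =
  bilinear_ladd[OF bilinear_N0] bilinear_radd[OF bilinear_N0]
  bilinear_lsub[OF bilinear_N0] bilinear_rsub[OF bilinear_N0]
  bilinear_lneg[OF bilinear_N0] bilinear_rneg[OF bilinear_N0]
  bilinear_lmul[OF bilinear_N0] bilinear_rmul[OF bilinear_N0]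
  bilinear_lzero[OF bilinear_N0] bilinear_rzero[OF bilinear_N0]

text \<open>Needed for arbitrary \<open>X\<close>: in the canonical connection \<open>J\<close> acts
  on Levi-Civita derivatives, which are known only through the Koszul formula for their products
  with the frame.\<close>

lemma g_J: "g (J X) e1 = g X e1" "g (J X) e2 = g X e2" "g (J X) e3 = - g X e3"
proof -
  have "J X = g X e1 *\<^sub>R e1 + g X e2 *\<^sub>R e2 + g X e3 *\<^sub>R e3"
    by (subst frame_expansion[of X, symmetric])
      (simp only: linear_add[OF linear_J] linear_diff[OF linear_J] linear_scale[OF linear_J]
        J_frame, simp)
  then show "g (J X) e1 = g X e1" "g (J X) e2 = g X e2" "g (J X) e3 = - g X e3"
    by (simp_all add: g_linear)
qed

lemma N0_frame [simp]:
  "N0 e1 e1 = 0" "N0 e1 e2 = 0" "N0 e1 e3 = 0"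
  "N0 e2 e1 = e2" "N0 e2 e2 = - e1" "N0 e2 e3 = 0"
  "N0 e3 e1 = (\<eta> + \<alpha> / 2) *\<^sub>R e2" "N0 e3 e2 = - (\<eta> + \<alpha> / 2) *\<^sub>R e1" "N0 e3 e3 = 0"
proof -
  have "bilinear (levi_civita br g)"
    using is_levi_civita by (simp add: is_levi_civita_def)
  note lin = g_linear bilinear_rneg[OF this] linear_neg[OF linear_J]
  show "N0 e1 e1 = 0" "N0 e1 e2 = 0" "N0 e1 e3 = 0"
    "N0 e2 e1 = e2" "N0 e2 e2 = - e1" "N0 e2 e3 = 0"
    "N0 e3 e1 = (\<eta> + \<alpha> / 2) *\<^sub>R e2" "N0 e3 e2 = - (\<eta> + \<alpha> / 2) *\<^sub>R e1" "N0 e3 e3 = 0"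
    by (rule frame_eqI; simp add: canonical_connection_def cov_deriv_endo_def g_J g_levi_civita lin
        field_simps)+
qed

abbreviation T0 where "T0 \<equiv> torsion br N0"

text \<open>The Wanas tensor nests one torsion in the first slot of another, so this is the slot to
  expand.\<close>

lemma T0_linear:
  "T0 (X + Y) Z = T0 X Z + T0 Y Z" "T0 (X - Y) Z = T0 X Z - T0 Y Z"
  "T0 (- X) Z = - T0 X Z" "T0 (r *\<^sub>R X) Z = r *\<^sub>R T0 X Z" "T0 0 Z = 0"
  by (simp_all add: torsion_def N0_linear br_linear algebra_simps)

lemma T0_frame [simp]:
  "T0 X X = 0"
  "T0 e1 e2 = (\<beta> - 2 * \<eta>) *\<^sub>R e3" "T0 e2 e1 = (2 * \<eta> - \<beta>) *\<^sub>R e3"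
  "T0 e1 e3 = (\<beta> - \<eta> - \<alpha> / 2) *\<^sub>R e2 - e3" "T0 e3 e1 = (\<eta> + \<alpha> / 2 - \<beta>) *\<^sub>R e2 + e3"
  "T0 e2 e3 = (\<eta> - \<alpha> / 2) *\<^sub>R e1" "T0 e3 e2 = (\<alpha> / 2 - \<eta>) *\<^sub>R e1"
  by (simp add: torsion_def)
    (rule frame_eqI; simp add: torsion_def g_linear; simp add: field_simps)+

abbreviation Wan0 where "Wan0 \<equiv> wanas_operator br g N0 e1 e2 e3"

lemma Wan0_frame:
  "Wan0 e1 = ((2 * \<eta> - \<beta>) * (2 * \<beta> - \<eta> - \<alpha> / 2) - 2) *\<^sub>R e1"
  "Wan0 e2 = ((2 * \<eta> - \<beta>) * (3 * \<alpha> / 2 - \<eta>) - 1) *\<^sub>R e2 + (\<eta> - \<alpha> / 2) *\<^sub>R e3"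
  "Wan0 e3 = (\<alpha> - \<beta>) *\<^sub>R e2 + (2 * (\<beta> - \<eta> - \<alpha> / 2) * (\<eta> - \<alpha> / 2)) *\<^sub>R e3"
  by (rule frame_eqI;
      simp add: g_wanas_operator[OF bilinear_N0] wanas_form_def wanas_tensor_def curvature_def
        g_linear N0_linear T0_linear; simp add: field_simps)+

text \<open>The pairs containing \<open>e1\<close> give the four entries of
  \<open>[D, M] = x M\<close>. Commutators and \<open>M\<close> are traceless, so the two diagonal
  entries give the same equation and three remain. The pair \<open>e2\<close>, \<open>e3\<close>
  gives the trace condition.\<close>

lemma lie_derivation_iff:
  assumes D: "linear D"
    and frame: "D e1 = x *\<^sub>R e1" "D e2 = y *\<^sub>R e2 + q *\<^sub>R e3" "D e3 = r *\<^sub>R e2 + z *\<^sub>R e3"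
  shows "lie_derivation br D \<longleftrightarrow>
    (2 * \<eta> - \<beta>) * r + x + \<beta> * q = 0 \<and> (2 * \<eta> - \<beta>) * (z - x - y) = 2 * q \<and>
    2 * r = \<beta> * (y - x - z) \<and> \<alpha> * x = \<alpha> * (y + z)" (is "_ \<longleftrightarrow> ?sys")
proof -
  \<comment> \<open>Reconciles the expanded and the cancelled form of the trace condition.\<close>
  have \<alpha>: "\<alpha> * x = \<alpha> * y + \<alpha> * z \<longleftrightarrow> \<alpha> = 0 \<or> x = y + z"
    by (simp flip: distrib_left)
  have "lie_derivation br D \<longleftrightarrow> D (br e1 e2) = br (D e1) e2 + br e1 (D e2) \<and>
      D (br e1 e3) = br (D e1) e3 + br e1 (D e3) \<and> D (br e2 e3) = br (D e2) e3 + br e2 (D e3)"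
    using lie_derivation_frameI[OF D] unfolding lie_derivation_def by blast
  also have "\<dots> \<longleftrightarrow> ?sys"
    by (simp add: frame br_linear linear_add[OF D] linear_diff[OF D] linear_neg[OF D]
        linear_scale[OF D] frame_eq_iff g_linear)
      (use \<alpha> in \<open>auto simp: algebra_simps\<close>)
  finally show ?thesis .
qed

end

section \<open>Solving the polynomial system\<close>

text \<open>The derivation equations for \<open>Wan0 - c Id\<close> at \<eta> = 1: \<open>x\<close>,
  \<open>y\<close>, \<open>z\<close> are its diagonal entries, while \<open>1 - \<alpha> / 2\<close>
  and \<open>\<alpha> - \<beta>\<close> are the off-diagonal ones.\<close>

lemma soliton_system_iff_normalized:
  fixes \<alpha> \<beta> c :: real
  defines "x \<equiv> (2 - \<beta>) * (2 * \<beta> - 1 - \<alpha> / 2) - 2 - c"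
    and "y \<equiv> (2 - \<beta>) * (3 * \<alpha> / 2 - 1) - 1 - c"
    and "z \<equiv> 2 * (\<beta> - 1 - \<alpha> / 2) * (1 - \<alpha> / 2) - c"
  shows "(2 - \<beta>) * (\<alpha> - \<beta>) + x + \<beta> * (1 - \<alpha> / 2) = 0 \<and> (2 - \<beta>) * (z - x - y) = 2 * (1 - \<alpha> / 2) \<and>
    2 * (\<alpha> - \<beta>) = \<beta> * (y - x - z) \<and> \<alpha> * x = \<alpha> * (y + z) \<longleftrightarrow>
    \<alpha> = 0 \<and> \<beta> = 0 \<and> c = -4 \<or> \<alpha> = 0 \<and> \<beta> = 1 \<and> c = -1" (is "?sys \<longleftrightarrow> ?sol")
proof
  assume ?sys
  then have E1: "(2 - \<beta>) * (\<alpha> - \<beta>) + x + \<beta> * (1 - \<alpha> / 2) = 0"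
    and E2: "(2 - \<beta>) * (z - x - y) = 2 * (1 - \<alpha> / 2)"
    and E3: "2 * (\<alpha> - \<beta>) = \<beta> * (y - x - z)" and E4: "\<alpha> * x = \<alpha> * (y + z)"
    by blast+
  show ?sol
  proof (cases "\<beta> = 1")
    \<comment> \<open>Here \<open>M\<close> is nilpotent and the trace argument says nothing about
      \<open>x\<close>, but \<open>E1\<close> yields it directly.\<close>
    case True
    have x: "x = - \<alpha> / 2"
      using E1 by (simp add: True field_simps)
    then have c: "c = -1"
      by (simp add: x_def True field_simps)
    have y: "y = 3 * \<alpha> / 2 - 1" and z: "z = \<alpha>\<^sup>2 / 2 - \<alpha> + 1"
      by (simp_all add: y_def z_def True c field_simps power2_eq_square)
    have "\<alpha> = 0"
    proof (rule ccontr)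
      assume "\<alpha> \<noteq> 0"
      then have "x = y + z"
        using E4 by simp
      then have "\<alpha> * (\<alpha> + 2) = 0"
        by (simp add: x y z field_simps power2_eq_square)
      then have "\<alpha> = -2"
        using \<open>\<alpha> \<noteq> 0\<close> by (simp add: add_eq_0_iff2)
      then show False
        using E2 by (simp add: x y z True)
    qed
    then show ?thesis
      using True c by simp
  next
    case False
    \<comment> \<open>Multiply \<open>[D, M] = x M\<close> by \<open>M\<close> and take the trace.\<close>
    have "2 * ((1 - \<beta>)\<^sup>2 * x) = 0"
      using E1 E2 E3 by algebra
    then have x: "x = 0"
      using False by simp
    \<comment> \<open>With \<open>x = 0\<close>, \<open>D\<close> commutes with \<open>M\<close>; on
      the plane it is \<open>(y + z) / 2\<close> times the identity plus \<open>s\<close> times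
      \<open>M\<close>.\<close>
    define s where "s = (z - y) / 2"
    have q: "1 - \<alpha> / 2 = (2 - \<beta>) * s" and r: "\<alpha> - \<beta> = - \<beta> * s"
      using E2 E3 by (simp_all add: x s_def field_simps)
    show ?thesis
    proof (cases "\<alpha> = 0")
      case True
      have "\<beta> = 0"
      proof (rule ccontr)
        assume "\<beta> \<noteq> 0"
        then have "s = 1"
          using r True by simp
        then show False
          using q True False by simp
      qed
      then show ?thesis
        using x True by (simp add: x_def)
    next
      case \<alpha>: False
      \<comment> \<open>The identity part disappears, leaving \<open>D = s M\<close> on the
        plane.\<close>
      then have "y + z = 0"
        using E4 x by simp
      then have y: "y = - s"
        by (simp add: s_def field_simps)
      have 1: "s * (4 - 3 * \<beta>) = 2 - \<beta>"
        using q r by algebra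
      \<comment> \<open>The difference eliminates \<open>c\<close>; together with \<open>r\<close>
        this gives a second equation in \<open>s\<close> and \<beta> alone.\<close>
      have "x - y = (2 - \<beta>) * (2 * (\<beta> - \<alpha>)) - 1"
        by (simp add: x_def y_def field_simps)
      then have 2: "s * (2 * (2 - \<beta>) * \<beta> - 1) = 1"
        using x y r by algebra
      have "4 - 3 * \<beta> = (2 - \<beta>) * (2 * (2 - \<beta>) * \<beta> - 1)"
        using 1 2 by algebra
      \<comment> \<open>Eliminating \<open>s\<close> leaves a cubic whose only real root is the
        excluded value 1.\<close>
      then have "(\<beta> - 1) * (\<beta>\<^sup>2 - 3 * \<beta> + 3) = 0"
        by algebra
      moreover have "\<beta>\<^sup>2 - 3 * \<beta> + 3 = (\<beta> - 3/2)\<^sup>2 + 3/4"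
        by (simp add: power2_eq_square algebra_simps)
      moreover have "(\<beta> - 3/2)\<^sup>2 + 3/4 > 0"
        by (simp add: add_nonneg_pos)
      ultimately show ?thesis
        using False by auto
    qed
  qed
next
  assume ?sol
  then show ?sys
    by (auto simp: x_def y_def z_def)
qed

text \<open>Replacing \<open>e3\<close> by \<open>- e3\<close> changes the signs of \<alpha>,
  \<beta> and \<eta> together, which reduces \<eta> = -1 to the normalized case.\<close>

lemma soliton_system_iff:
  fixes \<alpha> \<beta> \<eta> c :: real
  assumes "\<eta> \<in> {1, -1}"
  defines "x \<equiv> (2 * \<eta> - \<beta>) * (2 * \<beta> - \<eta> - \<alpha> / 2) - 2 - c"
    and "y \<equiv> (2 * \<eta> - \<beta>) * (3 * \<alpha> / 2 - \<eta>) - 1 - c"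
    and "z \<equiv> 2 * (\<beta> - \<eta> - \<alpha> / 2) * (\<eta> - \<alpha> / 2) - c"
  shows "(2 * \<eta> - \<beta>) * (\<alpha> - \<beta>) + x + \<beta> * (\<eta> - \<alpha> / 2) = 0 \<and>
    (2 * \<eta> - \<beta>) * (z - x - y) = 2 * (\<eta> - \<alpha> / 2) \<and>
    2 * (\<alpha> - \<beta>) = \<beta> * (y - x - z) \<and> \<alpha> * x = \<alpha> * (y + z) \<longleftrightarrow>
    \<alpha> = 0 \<and> \<beta> = 0 \<and> c = -4 \<or> \<alpha> = 0 \<and> \<beta> = \<eta> \<and> c = -1"
proof (cases "\<eta> = 1")
  case True
  then show ?thesis
    using soliton_system_iff_normalized[of \<beta> \<alpha> c] by (simp add: x_def y_def z_def)
next
  case False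
  then have "\<eta> = -1"
    using assms(1) by simp
  then show ?thesis
    using soliton_system_iff_normalized[of "- \<beta>" "- \<alpha>" c]
    unfolding x_def y_def z_def by (simp add: algebra_simps) argo
qed

theorem theorem2p15:
  fixes br :: "'a::real_vector \<Rightarrow> 'a \<Rightarrow> 'a"
    and g :: "'a \<Rightarrow> 'a \<Rightarrow> real"
    and J :: "'a \<Rightarrow> 'a"
    and e1 e2 e3 :: 'a
    and \<alpha> \<beta> \<eta> c :: real
  assumes "\<eta> \<in> {1, -1}"
    and "lie_bracket br"
    and "pseudo_metric g"
    and "pseudo_orthonormal_basis g e1 e2 e3"
    and "br e1 e2 = - e2 + (2 * \<eta> - \<beta>) *\<^sub>R e3"
    and "br e1 e3 = - \<beta> *\<^sub>R e2 + e3"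
    and "br e2 e3 = \<alpha> *\<^sub>R e1"
    and "linear J" and "J e1 = e1" and "J e2 = e2" and "J e3 = - e3"
  shows "(first_kind_soliton br g J e1 e2 e3 c \<longleftrightarrow>
            \<alpha> = 0 \<and> \<beta> = 0 \<and> c = -4 \<or> \<alpha> = 0 \<and> \<beta> = \<eta> \<and> c = -1) \<and>
         (\<forall>D. first_kind_soliton_with br g J e1 e2 e3 c D \<longrightarrow>
            (\<alpha> = 0 \<and> \<beta> = 0 \<and> c = -4 \<longrightarrow>
               D e1 = 0 \<and> D e2 = e2 + \<eta> *\<^sub>R e3 \<and> D e3 = 2 *\<^sub>R e3) \<and>
            (\<alpha> = 0 \<and> \<beta> = \<eta> \<and> c = -1 \<longrightarrow>
               D e1 = 0 \<and> D e2 = - e2 + \<eta> *\<^sub>R e3 \<and> D e3 = - \<eta> *\<^sub>R e2 + e3))"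
proof -
  interpret lie_algebra_G4 br g e1 e2 e3 J \<alpha> \<beta> \<eta>
    by (intro lie_algebra_G4.intro lorentzian_frame.intro lie_algebra_G4_axioms.intro assms)
  let ?D = "\<lambda>X. Wan0 X - c *\<^sub>R X"
  \<comment> \<open>The soliton equation determines \<open>D\<close>, so existence becomes a single
    derivation test and the explicit values can be read off from \<open>?D\<close>.\<close>
  have soliton: "first_kind_soliton_with br g J e1 e2 e3 c D \<longleftrightarrow> lie_derivation br ?D \<and> D = ?D" for D
  proof -
    have "(\<forall>X. Wan0 X = c *\<^sub>R X + D X) \<longleftrightarrow> D = ?D"
      by (auto simp: fun_eq_iff algebra_simps)
    then show ?thesis
      unfolding first_kind_soliton_with_def by auto
  qed
  have linear_D: "linear ?D"
    by (intro linear_compose_sub linear_wanas_operator bilinear_N0 linear_scale_self)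
  have D_frame:
    "?D e1 = ((2 * \<eta> - \<beta>) * (2 * \<beta> - \<eta> - \<alpha> / 2) - 2 - c) *\<^sub>R e1"
    "?D e2 = ((2 * \<eta> - \<beta>) * (3 * \<alpha> / 2 - \<eta>) - 1 - c) *\<^sub>R e2 + (\<eta> - \<alpha> / 2) *\<^sub>R e3"
    "?D e3 = (\<alpha> - \<beta>) *\<^sub>R e2 + (2 * (\<beta> - \<eta> - \<alpha> / 2) * (\<eta> - \<alpha> / 2) - c) *\<^sub>R e3"
    by (simp_all add: Wan0_frame scaleR_left_diff_distrib)
  have "first_kind_soliton br g J e1 e2 e3 c \<longleftrightarrow> lie_derivation br ?D"
    by (simp add: first_kind_soliton_def soliton)
  also have "\<dots> \<longleftrightarrow> \<alpha> = 0 \<and> \<beta> = 0 \<and> c = -4 \<or> \<alpha> = 0 \<and> \<beta> = \<eta> \<and> c = -1"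
    unfolding lie_derivation_iff[OF linear_D D_frame] by (rule soliton_system_iff[OF eta])
  finally have iff: "first_kind_soliton br g J e1 e2 e3 c \<longleftrightarrow>
      \<alpha> = 0 \<and> \<beta> = 0 \<and> c = -4 \<or> \<alpha> = 0 \<and> \<beta> = \<eta> \<and> c = -1" .
  from eta have "(\<alpha> = 0 \<and> \<beta> = 0 \<and> c = -4 \<longrightarrow>
        ?D e1 = 0 \<and> ?D e2 = e2 + \<eta> *\<^sub>R e3 \<and> ?D e3 = 2 *\<^sub>R e3) \<and>
      (\<alpha> = 0 \<and> \<beta> = \<eta> \<and> c = -1 \<longrightarrow>
        ?D e1 = 0 \<and> ?D e2 = - e2 + \<eta> *\<^sub>R e3 \<and> ?D e3 = - \<eta> *\<^sub>R e2 + e3)"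
    unfolding D_frame by (auto simp: frame_eq_iff g_linear)
  with iff show ?thesis
    by (simp add: soliton)
qed

end
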